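(* Consider the following algorithm. (i) Set $\mathbf p_0=\dfrac{\mathcal E_d}{\sum_{i=1}^m c_i}\,\mathbf 1_m$, where $\mathbf 1_m\in\mathbb R^m$ is the all-ones vector, and $L_0=L^\infty(I_n,\mathbf p_0)$. (ii) For $k=1,2,\dots$, let $\mathbf p_k$ be a solution of the optimization problem $$\text{minimize}_{\mathbf p\in\mathbb R^m}\ \operatorname{trace}(L(L_{k-1},\mathbf p))\quad\text{subject to}\quad L(L_{k-1},\mathbf p)\le L_{k-1},\ \ \mathbf p\in\mathcal P,\qquad(\ast)$$ and set $L_k=L(L_{k-1},\mathbf p_k)$. (iii) Let $\mathbf p^*$ be an accumulation point of the sequence $(\mathbf p_k)$ (the limit of a convergent subsequence). Then the following statements are true: 1. $L_0$ exists (i.e. the limit defining $L^\infty(I_n,\mathbf p_0)$ exists). 2. Problem $(\ast)$ is always feasible (i.e. feasible for every $k\ge1$). 3. $\mathbf p^*$ exists and $\mathbf p^*\in\mathcal P$. 4. $L_\infty=\lim_{k\to\infty}L_k$ exists. 5. $L_\infty=L^\infty(X,\mathbf p^* )$ for all positive semidefinite $X\in\mathbb R^{n\times n}$.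
   Context: Data: $A\in\mathbb R^{n\times n}$; $Q\in\mathbb R^{n\times n}$ symmetric positive definite; row vectors $C_1,\dots,C_m\in\mathbb R^{1\times n}$ with $C=[C_1',\dots,C_m']'$ (prime denotes transpose) and $(C,A)$ observable; $r_1,\dots,r_m>0$. Matrix inequalities are in the positive semidefinite order; $I_n$ is the identity matrix. Network: a directed tree with vertices $s_0,s_1,\dots,s_m$, rooted at the fusion center $s_0$; each sensor $s_i$, $i\ge1$, has exactly one outgoing edge, going to its parent, with weight $c_i$, the energy consumed when $s_i$ transmits a packet to its parent. $\mathcal E_d$ is a designated threshold on the expected energy consumption. For positive semidefinite $X\in\mathbb R^{n\times n}$ and $\mathbf p=[p_1,\dots,p_m]'\in\mathbb R^m$, $$L(X,\mathbf p)=\Big[(AXA'+Q)^{-1}+\sum_{i=1}^m p_i\frac{C_i'C_i}{r_i}\Big]^{-1},$$ $L^{(1)}(X,\mathbf p)=L(X,\mathbf p)$, $L^{(k)}(X,\mathbf p)=L(L^{(k-1)}(X,\mathbf p),\mathbf p)$, and $L^\infty(X,\mathbf p)=\lim_{k\to\infty}L^{(k)}(X,\mathbf p)$ when the limit exists. The feasible set is $$\mathcal P=\Big\{\mathbf p\in\mathbb R^m:\ p_i\in[0,1]\ \forall i,\ \ \sum_{i=1}^m c_ip_i\le\mathcal E_d,\ \ p_i\le p_j\text{ whenever } s_j\ (j\in\{1,\dots,m\})\text{ is the parent of } s_i\Big\}.$$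
   Formalization: The energy threshold is assumed to satisfy 0 < E_d ≤ Σ c_i: for E_d > Σ c_i problem (∗) is infeasible at k=1, for E_d < 0 the set P is empty, and for E_d = 0 (p_0 = 0) L_0 need not exist when A is unstable. *)

theory Defs
  imports "HOL-Analysis.Analysis"
begin

definition psd :: "real^'n^'n \<Rightarrow> bool" where
  "psd M \<longleftrightarrow> transpose M = M \<and> (\<forall>x. 0 \<le> x \<bullet> (M *v x))"

definition pos_def :: "real^'n^'n \<Rightarrow> bool" where
  "pos_def M \<longleftrightarrow> transpose M = M \<and> (\<forall>x. x \<noteq> 0 \<longrightarrow> 0 < x \<bullet> (M *v x))"

definition loewner_le :: "real^'n^'n \<Rightarrow> real^'n^'n \<Rightarrow> bool" where
  "loewner_le X Y \<longleftrightarrow> psd (Y - X)"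

(* The type real^'n^'n carries the entrywise product, so powers with respect to
   the matrix product need a separate definition. *)
definition mat_power :: "real^'n^'n \<Rightarrow> nat \<Rightarrow> real^'n^'n" where
  "mat_power A k = (((**) A) ^^ k) (mat 1)"

(* Kalman rank condition: the row vectors C_i A^k with k < n are the rows of the
   stacked observability matrix [C; C A; ...; C A^(n-1)], whose (row) rank is
   required to be n. *)
definition observable :: "real^'n^'m \<Rightarrow> real^'n^'n \<Rightarrow> bool" where
  "observable C A \<longleftrightarrow>
     dim {row i (C ** mat_power A k) | i k. k < CARD('n)} = CARD('n)"

(* The sensors s_1, ..., s_m are the elements of 'm. In the vertex type 'm option,
   None is the fusion center s_0 and Some i is a sensor. The only edge leaving Some i
   goes to parent i, and no edge leaves None; such a graph is a directed tree rooted
   at None iff every sensor has a path to None. *)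
definition tree_to_root :: "('m \<Rightarrow> 'm option) \<Rightarrow> bool" where
  "tree_to_root parent \<longleftrightarrow> (\<forall>i. (Some i, None) \<in> {(Some j, parent j) | j. True}\<^sup>*)"

(* C_i' C_i has (j,k) entry C_ij * C_ik. *)
definition L_op ::
  "real^'n^'n \<Rightarrow> real^'n^'n \<Rightarrow> real^'n^'m \<Rightarrow> ('m::finite \<Rightarrow> real)
     \<Rightarrow> real^'n^'n \<Rightarrow> real^'m \<Rightarrow> real^'n^'n" where
  "L_op A Q C r X p =
     matrix_inv (matrix_inv (A ** X ** transpose A + Q)
       + (\<Sum>i\<in>UNIV. (p $ i / r i) *\<^sub>R (\<chi> j k. C $ i $ j * C $ i $ k)))"

definition L_iter ::
  "real^'n^'n \<Rightarrow> real^'n^'n \<Rightarrow> real^'n^'m \<Rightarrow> ('m::finite \<Rightarrow> real)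
     \<Rightarrow> nat \<Rightarrow> real^'n^'n \<Rightarrow> real^'m \<Rightarrow> real^'n^'n" where
  "L_iter A Q C r k X p = ((\<lambda>Y. L_op A Q C r Y p) ^^ k) X"

(* Meaningful only when the sequence of iterates converges. *)
definition L_infty ::
  "real^'n^'n \<Rightarrow> real^'n^'n \<Rightarrow> real^'n^'m \<Rightarrow> ('m::finite \<Rightarrow> real)
     \<Rightarrow> real^'n^'n \<Rightarrow> real^'m \<Rightarrow> real^'n^'n" where
  "L_infty A Q C r X p = lim (\<lambda>k. L_iter A Q C r k X p)"

definition feasible_set ::
  "('m::finite \<Rightarrow> 'm option) \<Rightarrow> ('m \<Rightarrow> real) \<Rightarrow> real \<Rightarrow> (real^'m) set" where
  "feasible_set parent c Ed =
     {p. (\<forall>i. 0 \<le> p $ i \<and> p $ i \<le> 1)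
       \<and> (\<Sum>i\<in>UNIV. c i * p $ i) \<le> Ed
       \<and> (\<forall>i j. parent i = Some j \<longrightarrow> p $ i \<le> p $ j)}"

definition p_init :: "('m::finite \<Rightarrow> real) \<Rightarrow> real \<Rightarrow> real^'m" where
  "p_init c Ed = (\<chi> i. Ed / (\<Sum>j\<in>UNIV. c j))"

definition step_feasible ::
  "real^'n^'n \<Rightarrow> real^'n^'n \<Rightarrow> real^'n^'m \<Rightarrow> ('m::finite \<Rightarrow> real)
     \<Rightarrow> ('m \<Rightarrow> 'm option) \<Rightarrow> ('m \<Rightarrow> real) \<Rightarrow> real
     \<Rightarrow> real^'n^'n \<Rightarrow> real^'m \<Rightarrow> bool" where
  "step_feasible A Q C r parent c Ed Y p \<longleftrightarrow>
     loewner_le (L_op A Q C r Y p) Y \<and> p \<in> feasible_set parent c Ed"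

definition step_solution ::
  "real^'n^'n \<Rightarrow> real^'n^'n \<Rightarrow> real^'n^'m \<Rightarrow> ('m::finite \<Rightarrow> real)
     \<Rightarrow> ('m \<Rightarrow> 'm option) \<Rightarrow> ('m \<Rightarrow> real) \<Rightarrow> real
     \<Rightarrow> real^'n^'n \<Rightarrow> real^'m \<Rightarrow> bool" where
  "step_solution A Q C r parent c Ed Y p \<longleftrightarrow>
     is_arg_min (\<lambda>q. trace (L_op A Q C r Y q)) (step_feasible A Q C r parent c Ed Y) p"

(* The matrices L_k determined by the choices ps 1, ps 2, ... of the algorithm. *)
primrec L_seq ::
  "real^'n^'n \<Rightarrow> real^'n^'n \<Rightarrow> real^'n^'m \<Rightarrow> ('m::finite \<Rightarrow> real)
     \<Rightarrow> ('m \<Rightarrow> real) \<Rightarrow> real \<Rightarrow> (nat \<Rightarrow> real^'m) \<Rightarrow> nat \<Rightarrow> real^'n^'n" where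
  "L_seq A Q C r c Ed ps 0 = L_infty A Q C r (mat 1) (p_init c Ed)"
| "L_seq A Q C r c Ed ps (Suc k) = L_op A Q C r (L_seq A Q C r c Ed ps k) (ps (Suc k))"

(* ps 0, ..., ps N is a possible outcome of the first N steps; later values of ps are
   irrelevant. Optimal solutions need not be unique, hence a predicate and not a
   function. *)
definition partial_run ::
  "real^'n^'n \<Rightarrow> real^'n^'n \<Rightarrow> real^'n^'m \<Rightarrow> ('m::finite \<Rightarrow> real)
     \<Rightarrow> ('m \<Rightarrow> 'm option) \<Rightarrow> ('m \<Rightarrow> real) \<Rightarrow> real
     \<Rightarrow> nat \<Rightarrow> (nat \<Rightarrow> real^'m) \<Rightarrow> bool" where
  "partial_run A Q C r parent c Ed N ps \<longleftrightarrow>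
     ps 0 = p_init c Ed \<and>
     (\<forall>k\<in>{1..N}. step_solution A Q C r parent c Ed (L_seq A Q C r c Ed ps (k - 1)) (ps k))"

definition full_run ::
  "real^'n^'n \<Rightarrow> real^'n^'n \<Rightarrow> real^'n^'m \<Rightarrow> ('m::finite \<Rightarrow> real)
     \<Rightarrow> ('m \<Rightarrow> 'm option) \<Rightarrow> ('m \<Rightarrow> real) \<Rightarrow> real
     \<Rightarrow> (nat \<Rightarrow> real^'m) \<Rightarrow> bool" where
  "full_run A Q C r parent c Ed ps \<longleftrightarrow> (\<forall>N. partial_run A Q C r parent c Ed N ps)"

definition accumulation_point :: "(nat \<Rightarrow> 'a::topological_space) \<Rightarrow> 'a \<Rightarrow> bool" where
  "accumulation_point x l \<longleftrightarrow> (\<exists>s. strict_mono s \<and> (x \<circ> s) \<longlonglongrightarrow> l)"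

end

theory Submission
  imports Defs
begin

text \<open>
  Every iterate is studied through the quadratic form \<open>x \<bullet> (X *v x)\<close>, which turns the
  semidefinite order into pointwise inequalities between real numbers. With
  \<open>M = A X A' + Q\<close> and \<open>S = \<Sum>i. (p i / r i) C_i' C_i\<close>, one step is
  \<open>L(X) = (M\<^sup>-\<^sup>1 + S)\<^sup>-\<^sup>1\<close>. Two observations carry the proof.

  A positive semidefinite fixed point \<open>P = L(P)\<close> attracts every positive semidefinite \<open>X\<close>,
  whatever the nonnegative weights \<open>p\<close> are (\<open>L_iter_tendsto_fixed_point\<close>). If
  \<open>(1 - s) P \<le> X \<le> (1 + t) P\<close>, then adding \<open>Q > 0\<close> dilutes the relative error: for a
  \<open>\<theta> < 1\<close> with \<open>A P A' \<le> \<theta> (A P A' + Q)\<close>, the predicted matrices satisfy the same bounds with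
  \<open>\<theta> s\<close> and \<open>\<theta> t\<close>. The map \<open>M \<mapsto> (M\<^sup>-\<^sup>1 + S)\<^sup>-\<^sup>1\<close> does not increase relative errors, so the
  bounds survive the step, and the error decays geometrically. The lower bound may start from
  \<open>s = 1\<close>, that is from \<open>0 \<le> X\<close>, so every positive semidefinite \<open>X\<close> is covered.

  If all weights are positive and \<open>(C, A)\<close> is observable, a fixed point exists
  (\<open>fixed_point_exists\<close>): the iterates from \<open>0\<close> increase, and they are bounded because
  the quadratic form of the \<open>n\<close>-th iterate at \<open>x\<close> is at most the cost of any \<open>n\<close>-step control of
  the dual system \<open>z \<mapsto> A' (z - C' u)\<close> started at \<open>x\<close>, with the starting matrix \<open>X\<close> as terminal cost. By observability, some controls steer \<open>x\<close> to \<open>0\<close> in \<open>n\<close> steps, and their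
  cost does not depend on the matrix at which the iteration starts.

  The theorem follows. The uniform weights \<open>p_0\<close> have a fixed point, so \<open>L_0\<close> exists, equals it,
  and makes \<open>p_0\<close> feasible for the first problem. The map \<open>L\<close> is monotone, so
  \<open>L_k = L(L_{k-1}, p_k) \<le> L_{k-1}\<close> gives \<open>L(L_k, p_k) \<le> L_k\<close>: the choice of one step remains
  feasible for the next. Compactness provides minimizers and accumulation points. The
  matrices \<open>L_k\<close> decrease, hence converge, and by continuity of \<open>L\<close> along a subsequence their
  limit is a fixed point of \<open>L(\<cdot>, p*)\<close>; as such it attracts every positive semidefinite \<open>X\<close>.
\<close>

section \<open>Quadratic forms and definite matrices\<close>

definition quad :: "real^'n^'n \<Rightarrow> real^'n \<Rightarrow> real" where
  "quad M x = x \<bullet> (M *v x)"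

lemma quad_add: "quad (M + N) x = quad M x + quad N x"
  by (simp add: quad_def matrix_vector_mult_add_rdistrib inner_add_right)

lemma quad_diff: "quad (M - N) x = quad M x - quad N x"
  by (simp add: quad_def matrix_vector_mult_diff_rdistrib inner_diff_right)

lemma quad_scaleR: "quad (a *\<^sub>R M) x = a * quad M x"
  by (simp add: quad_def scaleR_matrix_vector_assoc [symmetric])

lemma quad_zero: "quad 0 x = 0"
  by (simp add: quad_def)

lemma quad_congruence: "quad (A ** X ** transpose A) x = quad X (transpose A *v x)"
  by (simp add: quad_def matrix_vector_mul_assoc [symmetric] transpose_matrix_vector
      dot_lmul_matrix)

lemma inner_transpose: "x \<bullet> (M *v y) = (transpose M *v x) \<bullet> y"
  for M :: "real^'n^'m"
  by (simp add: transpose_matrix_vector dot_lmul_matrix)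

lemma quad_scaleR_vec: "quad M (a *\<^sub>R x) = a^2 * quad M x"
  by (simp add: quad_def matrix_vector_mult_scaleR power2_eq_square)

lemma quad_polarization:
  assumes "transpose M = M"
  shows "quad M (x + y) = quad M x + 2 * (x \<bullet> (M *v y)) + quad M y"
proof -
  have "y \<bullet> (M *v x) = x \<bullet> (M *v y)"
    by (metis assms inner_commute inner_transpose)
  then show ?thesis
    by (simp add: quad_def matrix_vector_right_distrib inner_add_left inner_add_right)
qed

lemma transpose_add: "transpose (M + N) = transpose M + transpose N"
  by (simp add: transpose_def vec_eq_iff)

lemma psd_quad: "psd M \<longleftrightarrow> transpose M = M \<and> (\<forall>x. 0 \<le> quad M x)"
  by (simp add: psd_def quad_def)

lemma pos_def_quad: "pos_def M \<longleftrightarrow> transpose M = M \<and> (\<forall>x. x \<noteq> 0 \<longrightarrow> 0 < quad M x)"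
  by (simp add: pos_def_def quad_def)

lemma pos_def_imp_psd: "pos_def M \<Longrightarrow> psd M"
  unfolding psd_quad pos_def_quad
  by (metis inner_zero_left less_eq_real_def quad_def)

lemma pos_def_add: "pos_def M \<Longrightarrow> psd N \<Longrightarrow> pos_def (M + N)"
  by (simp add: psd_quad pos_def_quad transpose_add quad_add add_pos_nonneg)

lemma loewner_le_iff_quad:
  assumes "transpose X = X" "transpose Y = Y"
  shows "loewner_le X Y \<longleftrightarrow> (\<forall>x. quad X x \<le> quad Y x)"
proof -
  have "transpose (Y - X) = Y - X"
    using assms by (simp add: transpose_def vec_eq_iff)
  then show ?thesis
    by (simp add: loewner_le_def psd_quad quad_diff)
qed

lemma psd_congruence: "psd X \<Longrightarrow> psd (A ** X ** transpose A)"
  by (simp add: psd_quad quad_congruence matrix_transpose_mul matrix_mul_assoc)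

lemma pos_def_invertible:
  assumes "pos_def M"
  shows "invertible M"
proof -
  have "x = 0" if "M *v x = 0" for x
    using assms that by (metis pos_def_def inner_zero_right less_irrefl)
  then have "\<exists>B. B ** M = mat 1"
    unfolding matrix_left_invertible_ker by blast
  then show ?thesis
    by (simp add: invertible_left_inverse)
qed

lemma matrix_inv_mult:
  assumes "invertible (M :: real^'n^'n)"
  shows "M ** matrix_inv M = mat 1" "matrix_inv M ** M = mat 1"
  using someI_ex[OF assms[unfolded invertible_def]] by (simp_all add: matrix_inv_def)

lemma matrix_inv_vector:
  assumes "invertible (M :: real^'n^'n)"
  shows "M *v (matrix_inv M *v x) = x" "matrix_inv M *v (M *v x) = x"
  using matrix_inv_mult[OF assms] by (simp_all add: matrix_vector_mul_assoc)

lemma transpose_matrix_inv: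
  fixes M :: "real^'n^'n"
  assumes "transpose M = M" "invertible M"
  shows "transpose (matrix_inv M) = matrix_inv M"
proof -
  note inv = matrix_inv_mult[OF assms(2)]
  have "transpose (matrix_inv M) ** M = transpose (M ** matrix_inv M)"
    by (simp only: matrix_transpose_mul assms(1))
  then have "transpose (matrix_inv M) ** M = mat 1"
    by (simp only: inv(1) transpose_mat)
  then have "transpose (matrix_inv M) ** M ** matrix_inv M = matrix_inv M"
    by (simp only: matrix_mul_lid)
  then show ?thesis
    by (simp only: matrix_mul_assoc [symmetric] inv(1) matrix_mul_rid)
qed

lemma quad_matrix_inv:
  assumes "pos_def M"
  shows "quad M (matrix_inv M *v x) = quad (matrix_inv M) x"
  using matrix_inv_vector[OF pos_def_invertible[OF assms]]
  by (simp add: quad_def inner_commute)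

lemma pos_def_matrix_inv:
  assumes M: "pos_def M"
  shows "pos_def (matrix_inv M)"
proof -
  note inv = pos_def_invertible[OF M]
  have "0 < quad (matrix_inv M) x" if "x \<noteq> 0" for x
  proof -
    have "matrix_inv M *v x \<noteq> 0"
      using matrix_inv_vector(1)[OF inv, of x] that by (metis matrix_vector_mult_0_right)
    then show ?thesis
      using M quad_matrix_inv[OF M, of x] by (metis pos_def_quad)
  qed
  moreover have "transpose (matrix_inv M) = matrix_inv M"
    using M transpose_matrix_inv[OF _ inv] unfolding pos_def_def by blast
  ultimately show ?thesis unfolding pos_def_quad by blast
qed

text \<open>
  The Fenchel inequality between the conjugate forms of \<open>M\<close> and \<open>M\<^sup>-\<^sup>1\<close>, obtained by expanding
  \<open>quad M (y - M\<^sup>-\<^sup>1 x) \<ge> 0\<close>. It says that \<open>quad (M\<^sup>-\<^sup>1) x\<close> is the maximum over \<open>y\<close> of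
  \<open>2 (x \<bullet> y) - quad M y\<close>, attained at \<open>y = M\<^sup>-\<^sup>1 x\<close>; all comparisons of inverses below
  come from this variational formula.
\<close>

lemma young_inequality:
  assumes M: "pos_def M"
  shows "2 * (x \<bullet> y) \<le> quad M y + quad (matrix_inv M) x"
proof -
  define z where "z = (-1) *\<^sub>R (matrix_inv M *v x)"
  have "0 \<le> quad M (y + z)"
    using pos_def_imp_psd[OF M] unfolding psd_quad by blast
  moreover have "quad M (y + z) = quad M y + 2 * (y \<bullet> (M *v z)) + quad M z"
    using M unfolding pos_def_def by (intro quad_polarization) blast
  moreover have "M *v z = - x"
    unfolding z_def matrix_vector_mult_scaleR
      matrix_inv_vector(1)[OF pos_def_invertible[OF M]] by simp
  moreover have "quad M z = quad (matrix_inv M) x"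
    unfolding z_def quad_scaleR_vec quad_matrix_inv[OF M] by simp
  ultimately show ?thesis by (simp add: inner_commute)
qed

text \<open>
  The error covariance after fusing a prior of covariance \<open>M\<close> with independent measurements
  of total information \<open>S\<close>.
\<close>

definition posterior :: "real^'n^'n \<Rightarrow> real^'n^'n \<Rightarrow> real^'n^'n" where
  "posterior S M = matrix_inv (matrix_inv M + S)"

lemma pos_def_posterior:
  assumes "pos_def M" "psd S"
  shows "pos_def (posterior S M)"
  unfolding posterior_def using assms by (intro pos_def_matrix_inv pos_def_add)

text \<open>
  Inversion turns \<open>M \<le> t N\<close> into \<open>N\<^sup>-\<^sup>1 \<le> t M\<^sup>-\<^sup>1\<close>. Since \<open>t \<ge> 1\<close>, also \<open>S \<le> t S\<close>; adding
  this and inverting again gives the claim. The case \<open>t = 1\<close> is monotonicity.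
\<close>

lemma posterior_le_scaled:
  assumes M: "pos_def M" and N: "pos_def N" and S: "psd S" and t: "1 \<le> t"
    and le: "\<And>x. quad M x \<le> t * quad N x"
  shows "quad (posterior S M) x \<le> t * quad (posterior S N) x"
proof -
  have MS: "pos_def (matrix_inv M + S)" and NS: "pos_def (matrix_inv N + S)"
    using M N S by (auto intro: pos_def_add pos_def_matrix_inv)
  define y where "y = posterior S M *v x"
  define w where "w = matrix_inv N *v y"
  have "quad (matrix_inv N) y \<le> t * quad (matrix_inv M) y"
  proof -
    \<comment> \<open>Scaling \<open>w\<close> by \<open>1/t\<close> leaves \<open>quad M w / t\<close>, which \<open>le\<close> bounds by \<open>quad N w\<close>.\<close>
    have "2 * (y \<bullet> w) \<le> quad M ((1/t) *\<^sub>R w) * t + t * quad (matrix_inv M) y"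
      using young_inequality[OF M, of y "(1/t) *\<^sub>R w"] t by (simp add: field_simps)
    also have "quad M ((1/t) *\<^sub>R w) * t = (1/t) * quad M w"
      using t by (simp add: quad_scaleR_vec power2_eq_square)
    also have "\<dots> \<le> quad N w"
      using le[of w] t by (simp add: field_simps)
    also have "quad N w = y \<bullet> w"
      unfolding w_def quad_matrix_inv[OF N] by (simp add: quad_def)
    also have "y \<bullet> w = quad (matrix_inv N) y"
      by (simp add: w_def quad_def)
    finally show ?thesis by simp
  qed
  moreover have "quad S y \<le> t * quad S y"
    using mult_right_mono[OF t, of "quad S y"] S by (simp add: psd_quad)
  ultimately have "quad (matrix_inv N + S) y \<le> t * quad (matrix_inv M + S) y"
    by (simp add: quad_add algebra_simps)
  also have "quad (matrix_inv M + S) y = quad (posterior S M) x"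
    unfolding y_def posterior_def by (rule quad_matrix_inv[OF MS])
  finally have 1: "quad (matrix_inv N + S) ((1/t) *\<^sub>R y) \<le> (1/t) * quad (posterior S M) x"
    using t by (simp add: quad_scaleR_vec power2_eq_square field_simps)
  have "2 * (x \<bullet> ((1/t) *\<^sub>R y)) \<le> quad (matrix_inv N + S) ((1/t) *\<^sub>R y) + quad (posterior S N) x"
    unfolding posterior_def by (rule young_inequality[OF NS])
  moreover have "x \<bullet> y = quad (posterior S M) x"
    by (simp add: y_def quad_def)
  ultimately show ?thesis
    using 1 t by (simp add: field_simps)
qed

text \<open>The ratio of the two forms is homogeneous of degree 0 and bounded on the unit sphere.\<close>

lemma pos_def_dominates:
  fixes M Q :: "real^'n^'n"
  assumes Q: "pos_def Q"
  shows "\<exists>b\<ge>0. \<forall>x. quad M x \<le> b * quad Q x"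
proof -
  have cont: "continuous_on S (quad N)" for N :: "real^'n^'n" and S
    unfolding quad_def matrix_vector_mult_def inner_vec_def
    by (auto intro!: continuous_intros)
  let ?S = "sphere (0 :: real^'n) 1"
  have "continuous_on ?S (\<lambda>x. quad M x / quad Q x)"
  proof (intro continuous_intros cont ballI)
    fix x :: "real^'n" assume "x \<in> ?S"
    then have "x \<noteq> 0" by auto
    with Q show "quad Q x \<noteq> 0" by (metis pos_def_quad less_irrefl)
  qed
  moreover have "compact ?S" "?S \<noteq> {}" by auto
  ultimately obtain u where u: "u \<in> ?S" "\<And>x. x \<in> ?S \<Longrightarrow> quad M x / quad Q x \<le> quad M u / quad Q u"
    using continuous_attains_sup by (metis (no_types, lifting))
  define b where "b = max 0 (quad M u / quad Q u)"
  have "quad M x \<le> b * quad Q x" for x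
  proof (cases "x = 0")
    case True
    then show ?thesis by (simp add: quad_def)
  next
    case False
    define v where "v = (1 / norm x) *\<^sub>R x"
    have "v \<in> ?S" using False by (simp add: v_def)
    then have "quad M v / quad Q v \<le> b"
      using u(2) unfolding b_def by fastforce
    moreover have "0 < quad Q x"
      using Q False by (simp add: pos_def_quad)
    moreover have "quad M v / quad Q v = quad M x / quad Q x"
      using False by (simp add: v_def quad_scaleR_vec)
    ultimately show ?thesis by (simp add: field_simps)
  qed
  then show ?thesis by (intro exI[of _ b]) (auto simp: b_def)
qed

section \<open>Limits of matrices\<close>

text \<open>
  By polarization, the values of the quadratic form determine the entries of a symmetric matrix
  linearly, so convergence of matrices can be tested on quadratic forms.
\<close>

lemma symmetric_entry_quad:
  fixes M :: "real^'n^'n"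
  assumes "transpose M = M"
  shows "M $ i $ j = (quad M (axis i 1 + axis j 1) - quad M (axis i 1) - quad M (axis j 1)) / 2"
proof -
  have "axis i 1 \<bullet> (M *v axis j 1) = M $ i $ j"
    by (simp add: inner_axis' matrix_vector_mult_basis column_def)
  then show ?thesis
    using quad_polarization[OF assms, of "axis i 1" "axis j 1"] by simp
qed

lemma tendsto_quad:
  assumes "(X \<longlongrightarrow> M) F"
  shows "((\<lambda>k. quad (X k) x) \<longlongrightarrow> quad M x) F"
  unfolding quad_def matrix_vector_mult_def inner_vec_def using assms
  by (auto intro!: tendsto_intros)

lemma tendsto_symmetric_quadI:
  fixes X :: "'a \<Rightarrow> real^'n^'n"
  assumes X: "\<And>k. transpose (X k) = X k" and M: "transpose M = M"
    and lim: "\<And>x. ((\<lambda>k. quad (X k) x) \<longlongrightarrow> quad M x) F"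
  shows "(X \<longlongrightarrow> M) F"
  by (intro vec_tendstoI) (simp add: symmetric_entry_quad[OF X] symmetric_entry_quad[OF M],
      auto intro!: tendsto_intros lim)

lemma psd_limit:
  assumes lim: "X \<longlonglongrightarrow> M" and X: "\<And>k. psd (X k)"
  shows "psd M"
proof -
  have "(\<lambda>k. transpose (X k)) \<longlonglongrightarrow> transpose M"
    unfolding transpose_def using lim by (intro vec_tendstoI) (auto intro!: tendsto_intros)
  then have "transpose M = M"
    using X lim LIMSEQ_unique by (simp add: psd_def) 
  moreover have "0 \<le> quad M x" for x
    by (rule LIMSEQ_le_const[OF tendsto_quad[OF lim]]) (use X in \<open>auto simp: psd_quad\<close>)
  ultimately show ?thesis by (simp add: psd_quad)
qed

lemma psd_convergent_of_quad:
  fixes X :: "nat \<Rightarrow> real^'n^'n"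
  assumes X: "\<And>k. psd (X k)" and conv: "\<And>x. convergent (\<lambda>k. quad (X k) x)"
  shows "\<exists>M. psd M \<and> X \<longlonglongrightarrow> M"
proof -
  define M where "M = (\<chi> i j. lim (\<lambda>k. X k $ i $ j))"
  have sym: "transpose (X k) = X k" for k using X by (simp add: psd_def)
  have "convergent (\<lambda>k. X k $ i $ j)" for i j
    unfolding symmetric_entry_quad[OF sym, of _ i j] divide_inverse
    by (intro convergent_mult convergent_diff conv convergent_const)
  then have "X \<longlonglongrightarrow> M"
    by (intro vec_tendstoI) (simp add: M_def convergent_LIMSEQ_iff)
  then show ?thesis using psd_limit X by blast
qed

lemma tendsto_det:
  fixes X :: "'a \<Rightarrow> real^'n^'n"
  assumes "(X \<longlongrightarrow> M) F"
  shows "((\<lambda>k. det (X k)) \<longlongrightarrow> det M) F"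
  unfolding det_def using assms by (auto intro!: tendsto_intros)

text \<open>By Cramer's rule, the entries of the inverse are quotients of determinants.\<close>

lemma tendsto_matrix_inv:
  fixes X :: "'a \<Rightarrow> real^'n^'n"
  assumes lim: "(X \<longlongrightarrow> M) F" and M: "invertible M" and X: "\<And>k. invertible (X k)"
  shows "((\<lambda>k. matrix_inv (X k)) \<longlongrightarrow> matrix_inv M) F"
proof -
  define cof where "cof N i j = det (\<chi> a b. if b = i then axis j 1 $ a else N $ a $ b)"
    for N :: "real^'n^'n" and i j
  have cramer_inv: "matrix_inv N $ i $ j = cof N i j / det N"
    if N: "invertible N" for N :: "real^'n^'n" and i j
  proof -
    have "matrix_inv N $ i $ j = (matrix_inv N *v axis j 1) $ i"
      by (simp add: matrix_vector_mult_basis column_def)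
    also have "matrix_inv N *v axis j 1
        = (\<chi> k. det (\<chi> a b. if b = k then axis j 1 $ a else N $ a $ b) / det N)"
      using cramer[of N "matrix_inv N *v axis j 1" "axis j 1"] N
      by (simp add: matrix_inv_vector invertible_det_nz)
    finally show ?thesis by (simp add: cof_def)
  qed
  have "((\<lambda>k. cof (X k) i j) \<longlongrightarrow> cof M i j) F" for i j
    unfolding cof_def using lim
    by (intro tendsto_det vec_tendstoI) (auto intro!: tendsto_intros)
  moreover have "det M \<noteq> 0" using M by (simp add: invertible_det_nz)
  ultimately show ?thesis
    by (intro vec_tendstoI) (simp only: cramer_inv X M, intro tendsto_divide tendsto_det lim)
qed

section \<open>The Riccati step\<close>

lemma quad_sum: "quad (\<Sum>i\<in>I. M i) x = (\<Sum>i\<in>I. quad (M i) x)"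
  by (induction I rule: infinite_finite_induct) (simp_all add: quad_zero quad_add)

lemma quad_outer_product: "quad (\<chi> j k. v $ j * v $ k) x = (v \<bullet> x)\<^sup>2"
proof -
  have "(\<chi> j k. v $ j * v $ k) *v x = (v \<bullet> x) *\<^sub>R v"
    by (simp add: vec_eq_iff matrix_vector_mult_def inner_vec_def sum_distrib_left mult_ac)
  then show ?thesis
    by (simp add: quad_def power2_eq_square inner_commute)
qed

locale kalman_filter =
  fixes A Q :: "real^'n^'n" and C :: "real^'n^'m" and r :: "'m::finite \<Rightarrow> real"
  assumes Q: "pos_def Q" and r_pos: "\<And>i. 0 < r i"
begin

abbreviation "L \<equiv> L_op A Q C r"
abbreviation "iter k X p \<equiv> L_iter A Q C r k X p"
abbreviation "predict X \<equiv> A ** X ** transpose A + Q"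

definition info :: "real^'m \<Rightarrow> real^'n^'n" where
  "info p = (\<Sum>i\<in>UNIV. (p $ i / r i) *\<^sub>R (\<chi> j k. C $ i $ j * C $ i $ k))"

lemma L_eq_posterior: "L X p = posterior (info p) (predict X)"
  by (simp add: L_op_def posterior_def info_def)

lemma quad_info: "quad (info p) x = (\<Sum>i\<in>UNIV. p $ i / r i * ((C *v x) $ i)\<^sup>2)"
  by (simp add: info_def quad_sum quad_scaleR quad_outer_product matrix_vector_mul_component)

lemma psd_info:
  assumes "\<And>i. 0 \<le> p $ i"
  shows "psd (info p)"
proof -
  have "transpose (info p) = info p"
    by (simp add: info_def transpose_def vec_eq_iff mult.commute)
  moreover have "0 \<le> quad (info p) x" for x
    unfolding quad_info using assms r_pos by (intro sum_nonneg mult_nonneg_nonneg)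
      (auto intro: divide_nonneg_nonneg less_imp_le)
  ultimately show ?thesis by (simp add: psd_quad)
qed

lemma quad_predict: "quad (predict X) x = quad X (transpose A *v x) + quad Q x"
  unfolding quad_add quad_congruence ..

lemma pos_def_predict: "psd X \<Longrightarrow> pos_def (predict X)"
  using pos_def_add[OF Q psd_congruence] by (simp add: add.commute)

lemma pos_def_L: "psd X \<Longrightarrow> (\<And>i. 0 \<le> p $ i) \<Longrightarrow> pos_def (L X p)"
  unfolding L_eq_posterior by (intro pos_def_posterior pos_def_predict psd_info)

lemma psd_L: "psd X \<Longrightarrow> (\<And>i. 0 \<le> p $ i) \<Longrightarrow> psd (L X p)"
  by (rule pos_def_imp_psd [OF pos_def_L])

lemma L_mono:
  assumes "psd X" "psd Y" "\<And>i. 0 \<le> p $ i" and le: "\<And>x. quad X x \<le> quad Y x"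
  shows "quad (L X p) x \<le> quad (L Y p) x"
proof -
  have "quad (posterior (info p) (predict X)) x \<le> 1 * quad (posterior (info p) (predict Y)) x"
  proof (intro posterior_le_scaled pos_def_predict psd_info assms order_refl)
    show "quad (predict X) x \<le> 1 * quad (predict Y) x" for x
      unfolding quad_predict using le by simp
  qed
  then show ?thesis by (simp add: L_eq_posterior)
qed

lemma L_iter_0: "iter 0 X p = X"
  by (simp add: L_iter_def)

lemma L_iter_Suc: "iter (Suc k) X p = L (iter k X p) p"
  by (simp add: L_iter_def)

lemma L_iter_add: "iter (m + k) X p = iter m (iter k X p) p"
  by (simp add: L_iter_def funpow_add)

lemma psd_L_iter: "psd X \<Longrightarrow> (\<And>i. 0 \<le> p $ i) \<Longrightarrow> psd (iter k X p)"
  by (induction k) (simp_all add: L_iter_0 L_iter_Suc psd_L)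

lemma tendsto_L:
  assumes X: "(X \<longlongrightarrow> M) F" and p: "(p \<longlongrightarrow> q) F"
    and "psd M" "\<And>k. psd (X k)" "\<And>i. 0 \<le> q $ i" "\<And>k i. 0 \<le> p k $ i"
  shows "((\<lambda>k. L (X k) (p k)) \<longlongrightarrow> L M q) F"
proof -
  have "((\<lambda>k. predict (X k)) \<longlongrightarrow> predict M) F"
    unfolding matrix_matrix_mult_def plus_vec_def using X
    by (intro vec_tendstoI) (auto intro!: tendsto_intros)
  then have 1: "((\<lambda>k. matrix_inv (predict (X k))) \<longlongrightarrow> matrix_inv (predict M)) F"
    by (intro tendsto_matrix_inv pos_def_invertible pos_def_predict assms)
  have 2: "((\<lambda>k. info (p k)) \<longlongrightarrow> info q) F"
    unfolding info_def divide_inverse using p by (auto intro!: tendsto_intros)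
  show ?thesis
    unfolding L_eq_posterior posterior_def
    by (intro tendsto_matrix_inv tendsto_add 1 2 pos_def_invertible pos_def_add
        pos_def_matrix_inv pos_def_predict psd_info assms)
qed

section \<open>Contraction towards a fixed point\<close>

text \<open>
  Here \<open>\<theta>\<close> bounds the share of the process part \<open>A P A'\<close> in \<open>predict P\<close>. The term \<open>Q\<close> is common
  to both predictions, so an excess of \<open>X\<close> over \<open>P\<close> enters the prediction with factor \<open>\<theta>\<close> only.
\<close>

lemma L_contracts_above:
  assumes X: "psd X" and P: "psd P" and p: "\<And>i. 0 \<le> p $ i" and fp: "L P p = P"
    and th: "0 \<le> \<theta>" "\<And>x. quad P (transpose A *v x) \<le> \<theta> * quad (predict P) x"
    and s: "0 \<le> s" "\<And>x. quad X x \<le> (1 + s) * quad P x"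
  shows "quad (L X p) x \<le> (1 + \<theta> * s) * quad P x"
proof -
  have "quad (posterior (info p) (predict X)) x
      \<le> (1 + \<theta> * s) * quad (posterior (info p) (predict P)) x"
  proof (intro posterior_le_scaled pos_def_predict psd_info X P p)
    show "1 \<le> 1 + \<theta> * s" using th s by simp
    fix x
    have "quad (predict X) x \<le> (1 + s) * quad P (transpose A *v x) + quad Q x"
      unfolding quad_predict using s(2) by (intro add_right_mono)
    also have "\<dots> = quad (predict P) x + s * quad P (transpose A *v x)"
      unfolding quad_predict by (simp add: algebra_simps)
    also have "\<dots> \<le> quad (predict P) x + s * (\<theta> * quad (predict P) x)"
      by (intro add_left_mono mult_left_mono th s)
    finally show "quad (predict X) x \<le> (1 + \<theta> * s) * quad (predict P) x"
      by (simp add: algebra_simps)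
  qed
  then show ?thesis by (simp add: L_eq_posterior [symmetric] fp)
qed

lemma L_contracts_below:
  assumes X: "psd X" and P: "psd P" and p: "\<And>i. 0 \<le> p $ i" and fp: "L P p = P"
    and th: "0 \<le> \<theta>" "\<theta> < 1" "\<And>x. quad P (transpose A *v x) \<le> \<theta> * quad (predict P) x"
    and s: "0 \<le> s" "s \<le> 1" "\<And>x. (1 - s) * quad P x \<le> quad X x"
  shows "(1 - \<theta> * s) * quad P x \<le> quad (L X p) x"
proof -
  have pos: "0 < 1 - \<theta> * s"
    using th s by (smt (verit) mult_left_le)
  \<comment> \<open>The lower bound is the scaled comparison with the roles of \<open>X\<close> and \<open>P\<close> exchanged.\<close>
  have "quad (posterior (info p) (predict P)) x
      \<le> 1 / (1 - \<theta> * s) * quad (posterior (info p) (predict X)) x"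
  proof (intro posterior_le_scaled pos_def_predict psd_info X P p)
    show "1 \<le> 1 / (1 - \<theta> * s)" using pos th s by simp
    fix x
    have "quad (predict P) x - s * (\<theta> * quad (predict P) x)
        \<le> quad (predict P) x - s * quad P (transpose A *v x)"
      by (intro diff_left_mono mult_left_mono th s)
    also have "\<dots> = (1 - s) * quad P (transpose A *v x) + quad Q x"
      unfolding quad_predict by (simp add: algebra_simps)
    also have "\<dots> \<le> quad (predict X) x"
      unfolding quad_predict using s(3) by (intro add_right_mono)
    finally have "(1 - \<theta> * s) * quad (predict P) x \<le> quad (predict X) x"
      by (simp add: algebra_simps)
    then show "quad (predict P) x \<le> 1 / (1 - \<theta> * s) * quad (predict X) x"
      using pos by (simp add: pos_le_divide_eq mult.commute)
  qed
  then show ?thesis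
    using pos by (simp add: L_eq_posterior [symmetric] fp pos_le_divide_eq mult.commute)
qed

text \<open>
  The fixed point is positive definite, being a value of \<open>L\<close>, so every \<open>X\<close> lies between \<open>0\<close> and a
  multiple of it; iterating the two contraction estimates closes this bracket.
\<close>

lemma L_iter_tendsto_fixed_point:
  assumes X: "psd X" and P: "psd P" and p: "\<And>i. 0 \<le> p $ i" and fp: "L P p = P"
  shows "(\<lambda>k. iter k X p) \<longlonglongrightarrow> P"
proof -
  have P_pos: "pos_def P" using pos_def_L[OF P p] fp by simp
  obtain b where b: "0 \<le> b" "\<And>x. quad (A ** P ** transpose A) x \<le> b * quad Q x"
    using pos_def_dominates[OF Q] by blast
  \<comment> \<open>From \<open>A P A' \<le> b Q\<close>: adding \<open>b A P A'\<close> to both sides gives \<open>(b + 1) A P A' \<le> b (A P A' + Q)\<close>.\<close>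
  define \<theta> where "\<theta> = b / (b + 1)"
  have th: "0 \<le> \<theta>" "\<theta> < 1" using b by (auto simp: \<theta>_def)
  have th_le: "quad P (transpose A *v x) \<le> \<theta> * quad (predict P) x" for x
    using b(2)[of x] b(1) unfolding quad_congruence quad_predict \<theta>_def
    by (simp add: field_simps)
  obtain a where a: "0 \<le> a" "\<And>x. quad X x \<le> a * quad P x"
    using pos_def_dominates[OF P_pos] by blast
  have P_nonneg: "0 \<le> quad P x" for x using P by (simp add: psd_quad)
  have bounds: "(\<forall>x. (1 - \<theta> ^ k) * quad P x \<le> quad (iter k X p) x)
      \<and> (\<forall>x. quad (iter k X p) x \<le> (1 + \<theta> ^ k * a) * quad P x)" for k
  proof (induction k)
    case 0
    have "quad X x \<le> (1 + a) * quad P x" for x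
      using a(2)[of x] P_nonneg[of x] by (simp add: algebra_simps)
    then show ?case using X by (simp add: L_iter_0 psd_quad)
  next
    case (Suc k)
    have k: "0 \<le> \<theta> ^ k" "\<theta> ^ k \<le> 1" "0 \<le> \<theta> ^ k * a"
      using th a by (auto intro: power_le_one)
    note iter_psd = psd_L_iter[OF X p, of k]
    have "(1 - \<theta> * \<theta> ^ k) * quad P x \<le> quad (L (iter k X p) p) x" for x
      using Suc by (intro L_contracts_below iter_psd P p fp th th_le k) auto
    moreover have "quad (L (iter k X p) p) x \<le> (1 + \<theta> * (\<theta> ^ k * a)) * quad P x" for x
      using Suc by (intro L_contracts_above iter_psd P p fp th th_le k) auto
    ultimately show ?case by (simp add: L_iter_Suc mult.assoc)
  qed
  have th0: "(\<lambda>k. \<theta> ^ k) \<longlonglongrightarrow> 0"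
    using th by (intro LIMSEQ_power_zero) auto
  have "(\<lambda>k. quad (iter k X p) x) \<longlonglongrightarrow> quad P x" for x
  proof (rule tendsto_sandwich)
    show "(\<lambda>k. (1 - \<theta> ^ k) * quad P x) \<longlonglongrightarrow> quad P x"
      using tendsto_mult[OF tendsto_diff[OF tendsto_const th0] tendsto_const, of 1 "quad P x"]
      by simp
    show "(\<lambda>k. (1 + \<theta> ^ k * a) * quad P x) \<longlonglongrightarrow> quad P x"
      using tendsto_mult[OF tendsto_add[OF tendsto_const
          tendsto_mult[OF th0 tendsto_const]] tendsto_const, of 1 a "quad P x"]
      by simp
  qed (use bounds in auto)
  then show ?thesis
    using psd_L_iter[OF X p] P by (intro tendsto_symmetric_quadI) (auto simp: psd_def)
qed

end

section \<open>Existence of a fixed point\<close>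

lemma linear_vector_matrix_mult: "linear (\<lambda>z. z v* M)"
  for M :: "real^'n^'m"
  by (intro linearI) (simp_all add: vector_matrix_left_distrib scaleR_vector_matrix_assoc)

lemma linear_funpow:
  fixes f :: "'a::real_vector \<Rightarrow> 'a"
  assumes "linear f"
  shows "linear (f ^^ j)"
proof (induction j)
  case 0
  show ?case by (simp add: linear_iff)
next
  case (Suc j)
  then show ?case by (simp only: funpow.simps linear_compose assms)
qed

context kalman_filter
begin

text \<open>
  The estimation error of the direction \<open>x\<close> is at most that of the suboptimal linear
  estimator which weighs the measurements by \<open>u\<close>: the first term is the remaining prior error,
  the second the measurement noise. The proof splits \<open>x\<close> into \<open>x - C' u\<close> and \<open>C' u\<close> in the
  variational formula and bounds the two parts by the prior and the measurement information.
\<close>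

lemma quad_L_le:
  assumes X: "psd X" and p: "\<And>i. 0 < p $ i"
  shows "quad (L X p) x
    \<le> quad (predict X) (x - u v* C) + (\<Sum>i\<in>UNIV. r i / p $ i * (u $ i)\<^sup>2)"
proof -
  let ?N = "matrix_inv (predict X) + info p"
  define y where "y = L X p *v x"
  have N: "pos_def ?N"
    using p by (intro pos_def_add pos_def_matrix_inv pos_def_predict psd_info X)
      (simp add: less_imp_le)
  have "quad ?N y = quad (L X p) x"
    unfolding y_def L_eq_posterior posterior_def by (rule quad_matrix_inv[OF N])
  moreover have "x \<bullet> y = quad (L X p) x"
    by (simp add: y_def quad_def)
  ultimately have "quad (L X p) x
      = 2 * ((x - u v* C) \<bullet> y) - quad (matrix_inv (predict X)) y
        + (2 * (u \<bullet> (C *v y)) - quad (info p) y)"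
    by (simp add: quad_add inner_diff_left dot_lmul_matrix)
  moreover have "2 * ((x - u v* C) \<bullet> y) - quad (matrix_inv (predict X)) y
      \<le> quad (predict X) (x - u v* C)"
    using young_inequality[OF pos_def_predict[OF X], of y "x - u v* C"]
    by (simp add: inner_commute)
  moreover have "2 * (u \<bullet> (C *v y)) \<le> quad (info p) y + (\<Sum>i\<in>UNIV. r i / p $ i * (u $ i)\<^sup>2)"
  proof -
    have "2 * (u $ i * (C *v y) $ i)
        \<le> p $ i / r i * ((C *v y) $ i)\<^sup>2 + r i / p $ i * (u $ i)\<^sup>2" for i
    proof -
      let ?a = "p $ i / r i" and ?c = "(C *v y) $ i"
      have a: "0 < ?a" using p r_pos by simp
      have "0 \<le> (?a * ?c - u $ i)\<^sup>2 / ?a"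
        using a by (intro divide_nonneg_pos zero_le_power2)
      also have "\<dots> = ?a * ?c\<^sup>2 - 2 * (u $ i * ?c) + (u $ i)\<^sup>2 / ?a"
      proof -
        have "(a * c - w)\<^sup>2 / a = a * c\<^sup>2 - 2 * (w * c) + w\<^sup>2 / a" if "0 < a"
          for a c w :: real
          using that by (simp add: power2_eq_square field_simps)
        then show ?thesis using a .
      qed
      finally show ?thesis by (simp add: mult.commute)
    qed
    then show ?thesis
      unfolding quad_info inner_vec_def sum_distrib_left sum.distrib [symmetric]
      by (intro sum_mono) simp
  qed
  ultimately show ?thesis by linarith
qed

text \<open>
  The hypothesis says that the controls \<open>u (n - 1), \<dots>, u 0\<close>, applied in this order, steer the
  dual system \<open>z \<mapsto> A' (z - C' u)\<close> from \<open>x\<close> to \<open>0\<close>. Applying \<open>quad_L_le\<close> along this trajectory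
  leaves only the running cost, since the term with \<open>X\<close> is evaluated at \<open>0\<close>.
\<close>

lemma L_iter_quad_bounded_of_steering:
  assumes p: "\<And>i. 0 < p $ i"
    and "((\<lambda>z. z v* A) ^^ n) x = (\<Sum>j<n. ((\<lambda>z. z v* A) ^^ Suc j) (u j v* C))"
  shows "\<exists>B. \<forall>X. psd X \<longrightarrow> quad (iter n X p) x \<le> B"
  using assms(2)
proof (induction n arbitrary: x)
  case 0
  then show ?case by (auto simp: quad_def)
next
  case (Suc n)
  let ?T = "\<lambda>z. z v* A"
  note T_pow = linear_funpow[OF linear_vector_matrix_mult[of A]]
  define v where "v = x - u n v* C"
  have "(?T ^^ n) (?T v) = (?T ^^ Suc n) v"
    by (simp only: funpow_Suc_right comp_apply)
  also have "\<dots> = (?T ^^ Suc n) x - (?T ^^ Suc n) (u n v* C)"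
    unfolding v_def by (rule linear_diff[OF T_pow])
  also have "\<dots> = (\<Sum>j<n. (?T ^^ Suc j) (u j v* C))"
    using Suc.prems by simp
  finally obtain B where B: "\<And>X. psd X \<Longrightarrow> quad (iter n X p) (?T v) \<le> B"
    using Suc.IH by blast
  have "quad (iter (Suc n) X p) x \<le> B + quad Q v + (\<Sum>i\<in>UNIV. r i / p $ i * (u n $ i)\<^sup>2)"
    if X: "psd X" for X
  proof -
    have "psd (iter n X p)" using psd_L_iter[OF X] p by (simp add: less_imp_le)
    from quad_L_le[OF this p, of x "u n"] B[OF X] show ?thesis
      unfolding L_iter_Suc quad_predict v_def by simp
  qed
  then show ?case by blast
qed

text \<open>
  Observability makes the vectors \<open>A'^j C' u\<close> with \<open>j < n\<close> span the space. Expanding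
  \<open>A'^(n-1) x\<close> in them and applying \<open>A'\<close> once more yields the controls; the detour through
  exponent \<open>n - 1\<close> is needed because \<open>A'\<close> may be singular.
\<close>

lemma observable_steering:
  assumes obs: "observable C A"
  shows "\<exists>u. ((\<lambda>z. z v* A) ^^ CARD('n)) x
    = (\<Sum>j<CARD('n). ((\<lambda>z. z v* A) ^^ Suc j) (u j v* C))"
proof -
  let ?T = "\<lambda>z. z v* A"
  note T_pow = linear_funpow[OF linear_vector_matrix_mult[of A]]
  have lin: "linear (\<lambda>w. (?T ^^ j) (w v* C))" for j
    using linear_compose[OF linear_vector_matrix_mult[of C] T_pow[of j]] by (simp add: o_def)
  have power: "v v* mat_power A k = (?T ^^ k) v" for v k
  proof (induction k arbitrary: v)
    case 0
    then show ?case by (simp add: mat_power_def)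
  next
    case (Suc k)
    have "v v* mat_power A (Suc k) = (v v* A) v* mat_power A k"
      by (simp add: mat_power_def vector_matrix_mul_assoc)
    then show ?case by (simp only: Suc.IH funpow_Suc_right comp_apply)
  qed
  have row: "row i (C ** mat_power A k) = (?T ^^ k) (C $ i)" for i k
    unfolding power [symmetric]
    by (simp add: vec_eq_iff row_def matrix_matrix_mult_def vector_matrix_mult_def mult.commute)
  \<comment> \<open>The row space of the observability matrix, described by explicit control sequences.\<close>
  define R where "R = {\<Sum>j<CARD('n). (?T ^^ j) (u j v* C) | u. True}"
  have "subspace R"
  proof (rule subspaceI)
    show "0 \<in> R"
      unfolding R_def using linear_0[OF T_pow] by (auto intro!: exI[of _ "\<lambda>_. 0"])
  next
    fix a b assume "a \<in> R" "b \<in> R"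
    then obtain u w where "a = (\<Sum>j<CARD('n). (?T ^^ j) (u j v* C))"
      "b = (\<Sum>j<CARD('n). (?T ^^ j) (w j v* C))"
      unfolding R_def by blast
    then have "a + b = (\<Sum>j<CARD('n). (?T ^^ j) ((u j + w j) v* C))"
      by (simp add: linear_add[OF lin] sum.distrib)
    then show "a + b \<in> R" unfolding R_def by (auto intro!: exI[of _ "\<lambda>j. u j + w j"])
  next
    fix c a assume "a \<in> R"
    then obtain u where "a = (\<Sum>j<CARD('n). (?T ^^ j) (u j v* C))"
      unfolding R_def by blast
    then have "c *\<^sub>R a = (\<Sum>j<CARD('n). (?T ^^ j) ((c *\<^sub>R u j) v* C))"
      by (simp add: linear_scale[OF lin] scaleR_sum_right)
    then show "c *\<^sub>R a \<in> R" unfolding R_def by (auto intro!: exI[of _ "\<lambda>j. c *\<^sub>R u j"])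
  qed
  moreover have "row i (C ** mat_power A k) \<in> R" if k: "k < CARD('n)" for i k
  proof -
    have "axis i 1 v* C = column i (transpose C)"
      using matrix_vector_mult_basis[of "transpose C" i] by simp
    also have "\<dots> = C $ i"
      by (simp add: column_def transpose_def vec_eq_iff)
    finally have "C $ i = axis i 1 v* C" by (rule sym)
    then have "(?T ^^ k) (C $ i)
        = (\<Sum>j<CARD('n). if j = k then (?T ^^ k) (axis i 1 v* C) else 0)"
      using k by (simp add: sum.delta)
    also have "\<dots> = (\<Sum>j<CARD('n). (?T ^^ j) ((if j = k then axis i 1 else 0) v* C))"
      by (intro sum.cong) (auto simp: linear_0[OF T_pow])
    finally show ?thesis
      unfolding row R_def by (auto intro!: exI[of _ "\<lambda>j. if j = k then axis i 1 else 0"])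
  qed
  ultimately have "span {row i (C ** mat_power A k) | i k. k < CARD('n)} \<subseteq> R"
    by (intro span_minimal) auto
  moreover have "span {row i (C ** mat_power A k) | i k. k < CARD('n)} = UNIV"
    using obs unfolding observable_def by (subst dim_eq_full [symmetric]) simp
  ultimately have "(?T ^^ (CARD('n) - 1)) x \<in> R" by auto
  then obtain u where u: "(?T ^^ (CARD('n) - 1)) x = (\<Sum>j<CARD('n). (?T ^^ j) (u j v* C))"
    unfolding R_def by blast
  have "(?T ^^ CARD('n)) x = ?T ((?T ^^ (CARD('n) - 1)) x)"
    by (metis comp_apply funpow.simps(2) Suc_diff_1 zero_less_card_finite)
  also have "\<dots> = (\<Sum>j<CARD('n). (?T ^^ Suc j) (u j v* C))"
    unfolding u by (simp add: linear_sum[OF linear_vector_matrix_mult])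
  finally show ?thesis by blast
qed

lemma fixed_point_exists:
  assumes obs: "observable C A" and p: "\<And>i. 0 < p $ i"
  shows "\<exists>P. psd P \<and> L P p = P"
proof -
  have p0: "0 \<le> p $ i" for i using p by (simp add: less_imp_le)
  let ?X = "\<lambda>k. iter k 0 p"
  have zero: "psd (0 :: real^'n^'n)"
    by (simp add: psd_quad quad_zero transpose_def vec_eq_iff)
  have X: "psd (?X k)" for k by (rule psd_L_iter[OF zero p0])
  have "\<forall>x. quad (?X k) x \<le> quad (?X (Suc k)) x" for k
  proof (induction k)
    case 0
    show ?case using X[of "Suc 0"] by (simp add: L_iter_0 quad_zero psd_quad)
  next
    case (Suc k)
    show ?case
      unfolding L_iter_Suc[of "Suc k"] L_iter_Suc[of k 0 p]
      using Suc X[of k] X[of "Suc k"] p0 by (auto simp: L_iter_Suc intro: L_mono)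
  qed
  then have inc: "incseq (\<lambda>k. quad (?X k) x)" for x
    by (simp add: incseq_Suc_iff)
  have "convergent (\<lambda>k. quad (?X k) x)" for x
  proof -
    obtain u where "((\<lambda>z. z v* A) ^^ CARD('n)) x
        = (\<Sum>j<CARD('n). ((\<lambda>z. z v* A) ^^ Suc j) (u j v* C))"
      using observable_steering[OF obs] by blast
    from L_iter_quad_bounded_of_steering[OF p this] obtain B
      where B: "\<And>X. psd X \<Longrightarrow> quad (iter CARD('n) X p) x \<le> B"
      by blast
    have "quad (?X k) x \<le> B" for k
    proof -
      have "quad (?X k) x \<le> quad (?X (CARD('n) + k)) x"
        by (rule incseqD[OF inc]) simp
      also have "\<dots> \<le> B" unfolding L_iter_add by (rule B[OF X])
      finally show ?thesis .
    qed
    then obtain l where "(\<lambda>k. quad (?X k) x) \<longlonglongrightarrow> l"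
      using incseq_convergent[OF inc[of x], of B] by blast
    then show ?thesis by (rule convergentI)
  qed
  then obtain P where P: "psd P" "?X \<longlonglongrightarrow> P"
    using psd_convergent_of_quad[of ?X] X by blast
  have "(\<lambda>k. L (?X k) p) \<longlonglongrightarrow> L P p"
    by (intro tendsto_L P X p0 tendsto_const)
  moreover have "(\<lambda>k. L (?X k) p) \<longlonglongrightarrow> P"
    using LIMSEQ_Suc[OF P(2)] by (simp add: L_iter_Suc)
  ultimately show ?thesis using P(1) LIMSEQ_unique by blast
qed

end

section \<open>The scheduling algorithm\<close>

locale sensor_scheduling = kalman_filter A Q C r
  for A Q :: "real^'n^'n" and C :: "real^'n^'m" and r :: "'m::finite \<Rightarrow> real" +
  fixes parent :: "'m \<Rightarrow> 'm option" and c :: "'m \<Rightarrow> real" and Ed :: real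
  assumes obs: "observable C A" and Ed_pos: "0 < Ed" and Ed_le: "Ed \<le> (\<Sum>i\<in>UNIV. c i)"
begin

abbreviation "feasible \<equiv> feasible_set parent c Ed"
abbreviation "p0 \<equiv> p_init c Ed"
abbreviation "Ls ps k \<equiv> L_seq A Q C r c Ed ps k"

lemma p_init_pos: "0 < p0 $ i"
  using Ed_pos Ed_le by (simp add: p_init_def)

lemma p_init_feasible: "p0 \<in> feasible"
proof -
  have "0 < (\<Sum>i\<in>UNIV. c i)" using Ed_pos Ed_le by simp
  then show ?thesis
    using Ed_pos Ed_le
    by (simp add: feasible_set_def p_init_def sum_divide_distrib [symmetric]
        sum_distrib_right [symmetric])
qed

lemma feasible_nonneg: "p \<in> feasible \<Longrightarrow> 0 \<le> p $ i"
  by (simp add: feasible_set_def)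

lemma compact_feasible: "compact feasible"
proof -
  have "closed feasible"
    unfolding closed_sequential_limits
  proof (intro allI impI, elim conjE)
    fix x l assume x: "\<forall>n. x n \<in> feasible" and lim: "x \<longlonglongrightarrow> l"
    have comp: "(\<lambda>n. x n $ i) \<longlonglongrightarrow> l $ i" for i
      using lim by (rule tendsto_vec_nth)
    have "0 \<le> l $ i" "l $ i \<le> 1" for i
      using x LIMSEQ_le_const[OF comp] LIMSEQ_le_const2[OF comp]
      by (auto simp: feasible_set_def)
    moreover have "(\<Sum>i\<in>UNIV. c i * l $ i) \<le> Ed"
    proof (rule LIMSEQ_le_const2)
      show "(\<lambda>n. \<Sum>i\<in>UNIV. c i * x n $ i) \<longlonglongrightarrow> (\<Sum>i\<in>UNIV. c i * l $ i)"
        by (intro tendsto_intros comp)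
    qed (use x in \<open>auto simp: feasible_set_def\<close>)
    moreover have "l $ i \<le> l $ j" if "parent i = Some j" for i j
      by (rule LIMSEQ_le[OF comp comp]) (use x that in \<open>auto simp: feasible_set_def\<close>)
    ultimately show "l \<in> feasible" by (auto simp: feasible_set_def)
  qed
  moreover have "feasible \<subseteq> cbox 0 1"
    by (auto simp: feasible_set_def mem_box_cart one_vec_def)
  ultimately show ?thesis
    using bounded_cbox bounded_subset compact_eq_bounded_closed by blast
qed

lemma initial_covariance:
  shows initial_convergent: "(\<lambda>k. iter k (mat 1) p0) \<longlonglongrightarrow> Ls ps 0"
    and initial_psd: "psd (Ls ps 0)"
    and initial_fixed_point: "L (Ls ps 0) p0 = Ls ps 0"
proof -
  obtain P where P: "psd P" "L P p0 = P"
    using fixed_point_exists[OF obs] p_init_pos by blast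
  have "psd (mat 1 :: real^'n^'n)" by (simp add: psd_def transpose_mat)
  then have lim: "(\<lambda>k. iter k (mat 1) p0) \<longlonglongrightarrow> P"
    using P p_init_pos by (intro L_iter_tendsto_fixed_point) (auto intro: less_imp_le)
  then have "Ls ps 0 = P" by (simp add: L_infty_def limI)
  then show "(\<lambda>k. iter k (mat 1) p0) \<longlonglongrightarrow> Ls ps 0" "psd (Ls ps 0)"
    "L (Ls ps 0) p0 = Ls ps 0"
    using P lim by simp_all
qed

lemma L_le_iff:
  assumes "psd Y" "p \<in> feasible"
  shows "loewner_le (L Y p) Y \<longleftrightarrow> (\<forall>x. quad (L Y p) x \<le> quad Y x)"
  using assms psd_L[OF assms(1) feasible_nonneg[OF assms(2)]]
  by (intro loewner_le_iff_quad) (simp_all add: psd_def)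

text \<open>The constraint \<open>L(Y, p) \<le> Y\<close> survives the step \<open>Y \<mapsto> L(Y, p)\<close> by monotonicity of \<open>L\<close>.\<close>

lemma step_feasible_persists:
  assumes Y: "psd Y" and p: "step_feasible A Q C r parent c Ed Y p"
  shows "step_feasible A Q C r parent c Ed (L Y p) p"
proof -
  have pf: "p \<in> feasible" using p by (simp add: step_feasible_def)
  have LY: "psd (L Y p)" by (rule psd_L[OF Y feasible_nonneg[OF pf]])
  have "quad (L (L Y p) p) x \<le> quad (L Y p) x" for x
    using p L_le_iff[OF Y pf]
    by (intro L_mono LY Y feasible_nonneg[OF pf]) (simp add: step_feasible_def)
  then show ?thesis using L_le_iff[OF LY pf] pf by (simp add: step_feasible_def)
qed

lemma partial_run_feasible:
  assumes run: "partial_run A Q C r parent c Ed N ps" and "k \<le> N"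
  shows "psd (Ls ps k) \<and> (\<exists>q. step_feasible A Q C r parent c Ed (Ls ps k) q)"
  using \<open>k \<le> N\<close>
proof (induction k)
  case 0
  have "loewner_le (L (Ls ps 0) p0) (Ls ps 0)"
    using L_le_iff[OF initial_psd p_init_feasible] initial_fixed_point by simp
  then show ?case
    using initial_psd p_init_feasible unfolding step_feasible_def by blast
next
  case (Suc k)
  then have Y: "psd (Ls ps k)" by simp
  have "step_solution A Q C r parent c Ed (Ls ps k) (ps (Suc k))"
  proof -
    have "step_solution A Q C r parent c Ed (Ls ps (Suc k - 1)) (ps (Suc k))"
      using run Suc.prems unfolding partial_run_def by (elim conjE bspec) simp
    then show ?thesis by simp
  qed
  then have sf: "step_feasible A Q C r parent c Ed (Ls ps k) (ps (Suc k))"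
    by (simp add: step_solution_def is_arg_min_def)
  then have "psd (L (Ls ps k) (ps (Suc k)))"
    by (intro psd_L Y feasible_nonneg) (simp add: step_feasible_def)
  then show ?case using step_feasible_persists[OF Y sf] by auto
qed

text \<open>The constraint set is a closed subset of a compact set, and the objective is continuous on it.\<close>

lemma step_solution_exists:
  assumes Y: "psd Y" and ex: "\<exists>q. step_feasible A Q C r parent c Ed Y q"
  shows "\<exists>p. step_solution A Q C r parent c Ed Y p"
proof -
  let ?K = "{q. step_feasible A Q C r parent c Ed Y q}"
  have L_lim: "(\<lambda>k. L Y (x k)) \<longlonglongrightarrow> L Y l"
    if "x \<longlonglongrightarrow> l" "l \<in> feasible" "\<And>k. x k \<in> feasible" for x l
    using that by (intro tendsto_L tendsto_const Y feasible_nonneg) auto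
  have "closed ?K"
    unfolding closed_sequential_limits
  proof (intro allI impI, elim conjE)
    fix x l assume "\<forall>n. x n \<in> ?K" and lim: "x \<longlonglongrightarrow> l"
    then have xf: "x n \<in> feasible" and xle: "loewner_le (L Y (x n)) Y" for n
      by (auto simp: step_feasible_def)
    have lf: "l \<in> feasible"
      using compact_imp_closed[OF compact_feasible] xf lim
      unfolding closed_sequential_limits by blast
    have "quad (L Y l) z \<le> quad Y z" for z
      by (rule LIMSEQ_le_const2[OF tendsto_quad[OF L_lim[OF lim lf xf]]])
        (use xle L_le_iff[OF Y xf] in auto)
    then show "l \<in> ?K" using L_le_iff[OF Y lf] lf by (simp add: step_feasible_def)
  qed
  then have "compact (feasible \<inter> ?K)"
    by (rule compact_Int_closed[OF compact_feasible])
  moreover have "feasible \<inter> ?K = ?K" by (auto simp: step_feasible_def)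
  ultimately have "compact ?K" by simp
  moreover have "continuous_on ?K (\<lambda>q. trace (L Y q))"
    unfolding continuous_on_sequentially
  proof (intro allI ballI impI, elim conjE)
    fix x l assume "l \<in> ?K" "\<forall>n. x n \<in> ?K" "x \<longlonglongrightarrow> l"
    then have "(\<lambda>k. L Y (x k)) \<longlonglongrightarrow> L Y l"
      by (intro L_lim) (auto simp: step_feasible_def)
    then show "((\<lambda>q. trace (L Y q)) \<circ> x) \<longlonglongrightarrow> trace (L Y l)"
      unfolding trace_def o_def by (auto intro!: tendsto_intros)
  qed
  ultimately obtain p where "p \<in> ?K" "\<And>q. q \<in> ?K \<Longrightarrow> trace (L Y p) \<le> trace (L Y q)"
    using continuous_attains_inf[of ?K "\<lambda>q. trace (L Y q)"] ex by auto
  then show ?thesis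
    by (auto simp: step_solution_def is_arg_min_def not_less)
qed

text \<open>
  A minimizer is selected for each matrix rather than for each step, so that the run is obtained
  by plain recursion on the matrices.
\<close>

lemma full_run_exists: "\<exists>ps. full_run A Q C r parent c Ed ps"
proof -
  define sol where "sol Y = (SOME p. step_solution A Q C r parent c Ed Y p)" for Y
  define Y where "Y = rec_nat (L_infty A Q C r (mat 1) p0) (\<lambda>_ Z. L Z (sol Z))"
  define ps where "ps = case_nat p0 (\<lambda>k. sol (Y k))"
  have Ls: "Ls ps k = Y k" for k
    by (induction k) (simp_all add: Y_def ps_def)
  have "partial_run A Q C r parent c Ed N ps" for N
  proof (induction N)
    case 0
    show ?case by (simp add: partial_run_def ps_def)
  next
    case (Suc N)
    have "\<exists>p. step_solution A Q C r parent c Ed (Y N) p"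
      using partial_run_feasible[OF Suc, of N] step_solution_exists by (simp add: Ls)
    then have "step_solution A Q C r parent c Ed (Y N) (sol (Y N))"
      unfolding sol_def by (rule someI_ex)
    then have "step_solution A Q C r parent c Ed (Ls ps N) (ps (Suc N))"
      unfolding Ls by (simp add: ps_def)
    with Suc show ?case
      by (auto simp: partial_run_def le_Suc_eq)
  qed
  then show ?thesis unfolding full_run_def by blast
qed

context
  fixes ps
  assumes run: "full_run A Q C r parent c Ed ps"
begin

lemma run_psd: "psd (Ls ps k)"
  using partial_run_feasible[of k ps k] run by (simp add: full_run_def)

lemma run_step_feasible: "step_feasible A Q C r parent c Ed (Ls ps k) (ps (Suc k))"
proof -
  have "partial_run A Q C r parent c Ed (Suc k) ps"
    using run by (simp add: full_run_def)
  then have "step_solution A Q C r parent c Ed (Ls ps (Suc k - 1)) (ps (Suc k))"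
    unfolding partial_run_def by (elim conjE bspec) simp
  then show ?thesis by (simp add: step_solution_def is_arg_min_def)
qed

lemma run_feasible: "ps k \<in> feasible"
proof (cases k)
  case 0
  have "ps 0 = p0" using run by (auto simp: full_run_def partial_run_def)
  then show ?thesis using 0 p_init_feasible by simp
next
  case (Suc j)
  then show ?thesis using run_step_feasible[of j] by (simp add: step_feasible_def)
qed

lemma run_accumulates: "\<exists>pstar. accumulation_point ps pstar"
  using compact_feasible run_feasible
  unfolding compact_def accumulation_point_def by blast

lemma accumulation_point_feasible:
  assumes "accumulation_point ps pstar"
  shows "pstar \<in> feasible"
proof -
  obtain s where "(ps \<circ> s) \<longlonglongrightarrow> pstar"
    using assms by (auto simp: accumulation_point_def)
  then show ?thesis
    using compact_imp_closed[OF compact_feasible] run_feasible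
    unfolding closed_sequential_limits by (metis comp_apply)
qed

lemma run_converges: "\<exists>P. psd P \<and> Ls ps \<longlonglongrightarrow> P"
proof (rule psd_convergent_of_quad[OF run_psd])
  fix x
  have dec: "decseq (\<lambda>k. quad (Ls ps k) x)"
    unfolding decseq_Suc_iff
    using L_le_iff[OF run_psd run_feasible] run_step_feasible
    by (auto simp: step_feasible_def)
  have "0 \<le> quad (Ls ps k) x" for k
    using run_psd by (simp add: psd_quad)
  then obtain l where "(\<lambda>k. quad (Ls ps k) x) \<longlonglongrightarrow> l"
    using decseq_convergent[OF dec, of 0] by blast
  then show "convergent (\<lambda>k. quad (Ls ps k) x)" by (rule convergentI)
qed

text \<open>
  Along indices with \<open>p_k \<longlongrightarrow> p*\<close>, both \<open>L_{k-1}\<close> and \<open>L_k = L(L_{k-1}, p_k)\<close> tend to \<open>P\<close>, because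
  the whole sequence converges.
\<close>

lemma run_limit_fixed_point:
  assumes P: "psd P" "Ls ps \<longlonglongrightarrow> P" and acc: "accumulation_point ps pstar"
  shows "L P pstar = P"
proof -
  obtain s where s: "strict_mono s" and lim: "(ps \<circ> s) \<longlonglongrightarrow> pstar"
    using acc by (auto simp: accumulation_point_def)
  \<comment> \<open>The first index of the subsequence is dropped, since it may be \<open>0\<close>, which has no predecessor.\<close>
  define t where "t k = s (Suc k) - 1" for k
  have Suc_t: "Suc (t k) = s (Suc k)" for k
    using strict_mono_imp_increasing[OF s, of "Suc k"] by (simp add: t_def)
  have t: "strict_mono t"
  proof (rule strict_monoI)
    fix i j :: nat assume "i < j"
    then have "s (Suc i) < s (Suc j)" using s by (simp add: strict_mono_less)
    then show "t i < t j" using Suc_t[of i] Suc_t[of j] by linarith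
  qed
  have 1: "(\<lambda>k. Ls ps (t k)) \<longlonglongrightarrow> P"
    using LIMSEQ_subseq_LIMSEQ[OF P(2) t] by (simp add: o_def)
  have 2: "(\<lambda>k. ps (Suc (t k))) \<longlonglongrightarrow> pstar"
    unfolding Suc_t using LIMSEQ_Suc[OF lim] by (simp add: o_def)
  have "(\<lambda>k. L (Ls ps (t k)) (ps (Suc (t k)))) \<longlonglongrightarrow> L P pstar"
    by (intro tendsto_L 1 2 P(1) run_psd feasible_nonneg run_feasible
        accumulation_point_feasible[OF acc])
  moreover have "(\<lambda>k. L (Ls ps (t k)) (ps (Suc (t k)))) \<longlonglongrightarrow> P"
    using LIMSEQ_subseq_LIMSEQ[OF LIMSEQ_Suc[OF P(2)] t] by (simp add: o_def)
  ultimately show ?thesis by (rule LIMSEQ_unique)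
qed

lemma run_limit_attracts:
  assumes acc: "accumulation_point ps pstar" and X: "psd X"
  shows "(\<lambda>k. iter k X pstar) \<longlonglongrightarrow> lim (Ls ps)"
proof -
  obtain P where P: "psd P" "Ls ps \<longlonglongrightarrow> P" using run_converges by blast
  have "(\<lambda>k. iter k X pstar) \<longlonglongrightarrow> P"
    using X P(1) feasible_nonneg[OF accumulation_point_feasible[OF acc]]
      run_limit_fixed_point[OF P acc] by (rule L_iter_tendsto_fixed_point)
  then show ?thesis using limI[OF P(2)] by simp
qed

end

end

theorem theorem4:
  fixes A Q :: "real^'n^'n"
    and C :: "real^'n^'m"
    and r c :: "'m::finite \<Rightarrow> real"
    and parent :: "'m \<Rightarrow> 'm option"
    and Ed :: real
  assumes Q: "pos_def Q"
    and obs: "observable C A"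
    and r_pos: "\<And>i. 0 < r i"
    and tree: "tree_to_root parent"
    and c_nonneg: "\<And>i. 0 \<le> c i"
    and Ed_pos: "0 < Ed"
    and Ed_le: "Ed \<le> (\<Sum>i\<in>UNIV. c i)"
  shows
    "convergent (\<lambda>k. L_iter A Q C r k (mat 1) (p_init c Ed))
   \<and> (\<forall>k\<ge>1. \<forall>ps. partial_run A Q C r parent c Ed (k - 1) ps \<longrightarrow>
        (\<exists>q. step_feasible A Q C r parent c Ed (L_seq A Q C r c Ed ps (k - 1)) q))
   \<and> (\<exists>ps. full_run A Q C r parent c Ed ps)
   \<and> (\<forall>ps. full_run A Q C r parent c Ed ps \<longrightarrow>
        (\<exists>pstar. accumulation_point ps pstar)
      \<and> (\<forall>pstar. accumulation_point ps pstar \<longrightarrow> pstar \<in> feasible_set parent c Ed)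
      \<and> convergent (L_seq A Q C r c Ed ps)
      \<and> (\<forall>pstar X. accumulation_point ps pstar \<and> psd X \<longrightarrow>
           convergent (\<lambda>k. L_iter A Q C r k X pstar)
         \<and> lim (L_seq A Q C r c Ed ps) = L_infty A Q C r X pstar))"
proof -
  interpret sensor_scheduling A Q C r parent c Ed
    by unfold_locales (use Q obs r_pos Ed_pos Ed_le in auto)
  have "convergent (\<lambda>k. L_iter A Q C r k (mat 1) p0)"
    using initial_convergent unfolding convergent_def by blast
  moreover have "\<exists>q. step_feasible A Q C r parent c Ed (Ls ps (k - 1)) q"
    if "partial_run A Q C r parent c Ed (k - 1) ps" for k ps
    using partial_run_feasible[OF that order_refl] by blast
  moreover have "convergent (Ls ps)" if "full_run A Q C r parent c Ed ps" for ps
    using run_converges[OF that] unfolding convergent_def by blast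
  moreover have "convergent (\<lambda>k. iter k X pstar) \<and> lim (Ls ps) = L_infty A Q C r X pstar"
    if "full_run A Q C r parent c Ed ps" "accumulation_point ps pstar" "psd X" for ps pstar X
    using run_limit_attracts[OF that] limI unfolding convergent_def L_infty_def by metis
  ultimately show ?thesis
    using full_run_exists run_accumulates accumulation_point_feasible by blast
qed

end
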